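(* Let $G=(V,E,L)$ be a looped simple graph and let $f_0$ (with integer $t\geq 1$), $f_1$ and $f_1^D$ (with integer $t\geq 2$) be the functions defined below. For $i\in\{0,1\}$ put $\mathcal{I}_{f_i}=\{T\subseteq E\cup L: |I|\leq f_i(I)\text{ for all }I\subseteq T\}$. Then $(E\cup L,\mathcal{I}_{f_i})$ is a matroid, with rank function $\hat f_0(T)=\min\{|T'|+f_0(T\setminus T'):T'\subseteq T\}$ for $i=0$, and $$\hat f_1(T)=\min\{|T'|+f_1^D(T\setminus T'):T'\subseteq T\}=\min\Big\{|T'|+\sum_{j=0}^k f_1(T_j): T'\subseteq T,\ \{T_0,\ldots,T_k\}\text{ a partition of }T\setminus T'\Big\}$$ for $i=1$.
   Context: A looped simple graph $G=(V,E,L)$ has vertex set $V$, simple edges $E$ (no multiple edges) and loops $L$. For $T\subseteq E\cup L$, $V(T)$ is the set of vertices incident to members of $T$. For a positive integer $t$, $f_0(T)=t|V(T)|$. For an integer $t>1$, $f_1(T)=|T|$ if $T\subseteq E$ and $|V(T)|\leq 2t$; $f_1(T)=t|V(T)|-1$ if $T\subseteq E$ and $|V(T)|=2t+1$; $f_1(T)=t|V(T)|$ if ($T\subseteq E$ and $|V(T)|\geq 2t+2$) or $T\cap L\neq\emptyset$. The Dilworth truncation is $f_1^D(T)=\min\{\sum_{j=1}^k f_1(T_j):\{T_1,\ldots,T_k\}\text{ a partition of }T\}$. *)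

theory Defs
  imports Main "HOL-Library.Disjoint_Sets"
begin

text \<open>
  Edges and loops are abstract elements of a type \<open>'e\<close>, and \<open>ends\<close> gives their end-vertices.
  Injectivity of \<open>ends\<close> is required on \<open>E\<close> only: there are no multiple edges, but a vertex
  may carry several loops.
\<close>

locale looped_simple_graph =
  fixes V :: "'v set" and E L :: "'e set" and ends :: "'e \<Rightarrow> 'v set"
  assumes finite_V: "finite V"
    and finite_E: "finite E"
    and finite_L: "finite L"
    and disjoint_E_L: "E \<inter> L = {}"
    and edge_ends: "\<And>e. e \<in> E \<Longrightarrow> ends e \<subseteq> V \<and> card (ends e) = 2"
    and loop_ends: "\<And>l. l \<in> L \<Longrightarrow> ends l \<subseteq> V \<and> card (ends l) = 1"
    and simple_edges: "inj_on ends E"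

definition verts :: "('e \<Rightarrow> 'v set) \<Rightarrow> 'e set \<Rightarrow> 'v set"
  where "verts ends T = (\<Union>e\<in>T. ends e)"

definition f0 :: "('e \<Rightarrow> 'v set) \<Rightarrow> nat \<Rightarrow> 'e set \<Rightarrow> nat"
  where "f0 ends t T = t * card (verts ends T)"

text \<open>
  For \<open>T \<subseteq> E \<union> L\<close> the last branch is reached exactly when \<open>T \<subseteq> E\<close> spans at least \<open>2 * t + 2\<close>
  vertices or \<open>T\<close> contains a loop. The subtraction does not truncate for \<open>t \<ge> 1\<close>.
\<close>

definition f1 :: "'e set \<Rightarrow> ('e \<Rightarrow> 'v set) \<Rightarrow> nat \<Rightarrow> 'e set \<Rightarrow> nat"
  where "f1 E ends t T =
    (if T \<subseteq> E \<and> card (verts ends T) \<le> 2 * t then card T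
     else if T \<subseteq> E \<and> card (verts ends T) = 2 * t + 1 then t * card (verts ends T) - 1
     else t * card (verts ends T))"

text \<open>
  The parts of \<^const>\<open>partition_on\<close> are nonempty, and the empty set has the empty partition,
  whose sum is \<open>0\<close>.
\<close>

definition dilworth_truncation :: "('e set \<Rightarrow> nat) \<Rightarrow> 'e set \<Rightarrow> nat"
  where "dilworth_truncation f T = Min {\<Sum>X\<in>P. f X | P. partition_on T P}"

definition indep_family :: "'e set \<Rightarrow> ('e set \<Rightarrow> nat) \<Rightarrow> 'e set set"
  where "indep_family S f = {T. T \<subseteq> S \<and> (\<forall>I\<subseteq>T. card I \<le> f I)}"

locale matroid =
  fixes S :: "'e set" and \<I> :: "'e set set"
  assumes finite_ground: "finite S"
    and indep_subset_ground: "\<And>X. X \<in> \<I> \<Longrightarrow> X \<subseteq> S"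
    and indep_empty: "{} \<in> \<I>"
    and indep_subset: "\<And>X Y. X \<in> \<I> \<Longrightarrow> Y \<subseteq> X \<Longrightarrow> Y \<in> \<I>"
    and indep_augment: "\<And>X Y. X \<in> \<I> \<Longrightarrow> Y \<in> \<I> \<Longrightarrow> card X < card Y \<Longrightarrow>
      \<exists>y\<in>Y - X. insert y X \<in> \<I>"

definition matroid_rank :: "'e set set \<Rightarrow> 'e set \<Rightarrow> nat"
  where "matroid_rank \<I> T = Max {card X | X. X \<in> \<I> \<and> X \<subseteq> T}"

end

theory Submission
  imports Defs
begin

text \<open>
  A maximal independent subset \<open>B\<close> of \<open>T\<close> is shown to attain the minimum in the rank formula, by
  covering \<open>T - B\<close> with sets that are tight in \<open>B\<close>; equicardinality of the maximal independent
  subsets then gives the matroid. For \<open>f0\<close> the union of all tight sets does it. The function \<open>f1\<close>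
  is not intersecting submodular: it is just the cardinality on edge sets spanning at most \<open>2 * t\<close>
  vertices, and such sets may overlap in a large but sparse union. It is, however, submodular on
  the remaining (``big'') sets whenever their vertex sets meet, and only big tight sets block the
  extension of \<open>B\<close>. So the maximal big tight subsets of \<open>B\<close> have pairwise disjoint vertex sets,
  and adding to each the elements of \<open>T - B\<close> that it spans yields the required partition.
\<close>

section \<open>Independence families with a min-max formula\<close>

text \<open>\<open>F T\<close> collects the candidate values of the rank formula. By
  \<open>weak\<close> they all bound the independent subsets of \<open>T\<close>, and by
  \<open>strong\<close> every maximal such subset attains one. Hence maximal independent subsets of
  \<open>T\<close> are equicardinal, with the minimum as their size.\<close>

lemma matroid_and_rank_of_min_max:
  assumes S: "finite S"
    and ground: "\<And>X. X \<in> J \<Longrightarrow> X \<subseteq> S"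
    and empty: "{} \<in> J"
    and hereditary: "\<And>X Y. X \<in> J \<Longrightarrow> Y \<subseteq> X \<Longrightarrow> Y \<in> J"
    and weak: "\<And>T X n. T \<subseteq> S \<Longrightarrow> X \<in> J \<Longrightarrow> X \<subseteq> T \<Longrightarrow> n \<in> F T \<Longrightarrow> card X \<le> n"
    and strong: "\<And>T X. T \<subseteq> S \<Longrightarrow> X \<in> J \<Longrightarrow> X \<subseteq> T \<Longrightarrow>
      (\<And>e. e \<in> T - X \<Longrightarrow> insert e X \<notin> J) \<Longrightarrow> card X \<in> F T"
  shows "matroid S J"
    and "T \<subseteq> S \<Longrightarrow> finite (F T) \<Longrightarrow> matroid_rank J T = Min (F T)"
proof -
  show "matroid S J"
  proof
    fix X Y assume XY: "X \<in> J" "Y \<in> J" "card X < card Y"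
    show "\<exists>y\<in>Y - X. insert y X \<in> J"
    proof (rule ccontr)
      assume *: "\<not> (\<exists>y\<in>Y - X. insert y X \<in> J)"
      have U: "X \<union> Y \<subseteq> S" using XY ground by blast
      \<comment> \<open>Without augmentation \<open>X\<close> is maximal in
        \<open>X \<union> Y\<close>, so its size is one of the values bounding
        \<open>card Y\<close>.\<close>
      have "card X \<in> F (X \<union> Y)" using * XY by (intro strong U) auto
      with weak[OF U XY(2)] have "card Y \<le> card X" by blast
      with XY(3) show False by simp
    qed
  qed (use S ground empty hereditary in blast)+
  show "matroid_rank J T = Min (F T)" if T: "T \<subseteq> S" and fin: "finite (F T)"
  proof -
    let ?K = "{X. X \<in> J \<and> X \<subseteq> T}"
    have "finite T" using T S finite_subset by blast
    then have "finite ?K" by simp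
    moreover have "{} \<in> ?K" using empty by simp
    ultimately obtain X where X: "X \<in> ?K" and Xmax: "\<And>Y. Y \<in> ?K \<Longrightarrow> X \<subseteq> Y \<Longrightarrow> X = Y"
      using finite_has_maximal2[of ?K "{}"] by auto
    have mem: "card X \<in> F T"
    proof (rule strong[OF T])
      fix e assume e: "e \<in> T - X"
      show "insert e X \<notin> J"
      proof
        assume "insert e X \<in> J"
        then have "X = insert e X" using X e by (intro Xmax) auto
        with e show False by blast
      qed
    qed (use X in auto)
    have "Min (F T) = card X"
      using mem weak[OF T] X fin by (intro Min_eqI) auto
    moreover have "matroid_rank J T = card X"
      unfolding matroid_rank_def
    proof (rule Max_eqI)
      show "finite {card X |X. X \<in> J \<and> X \<subseteq> T}"
        using \<open>finite ?K\<close> by simp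
    qed (use X mem weak[OF T] in auto)
    ultimately show ?thesis by simp
  qed
qed

section \<open>Independent sets and tight sets of a monotone function\<close>

lemma indep_familyD: "X \<in> indep_family S f \<Longrightarrow> I \<subseteq> X \<Longrightarrow> card I \<le> f I"
  by (simp add: indep_family_def)

lemma indep_family_subset: "X \<in> indep_family S f \<Longrightarrow> Y \<subseteq> X \<Longrightarrow> Y \<in> indep_family S f"
  by (auto simp: indep_family_def)

lemma empty_in_indep_family: "{} \<in> indep_family S f"
  by (simp add: indep_family_def)

text \<open>A set \<open>I\<close> violating the bound must contain \<open>e\<close>. With
  \<open>C = I - {e}\<close>, the chain \<open>card C \<le> f C \<le> f I < card C + 1\<close>
  collapses to equalities.\<close>

lemma tight_set_if_not_extendable:
  assumes S: "finite S"
    and mono: "\<And>X Y. X \<subseteq> Y \<Longrightarrow> Y \<subseteq> S \<Longrightarrow> f X \<le> f Y"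
    and B: "B \<in> indep_family S f" and e: "e \<in> S - B" and dep: "insert e B \<notin> indep_family S f"
  obtains C where "C \<subseteq> B" "f C = card C" "f (insert e C) = card C"
proof -
  have BS: "B \<subseteq> S" using B by (simp add: indep_family_def)
  with e have eB: "insert e B \<subseteq> S" by blast
  with dep have "\<exists>I \<subseteq> insert e B. \<not> card I \<le> f I" by (simp add: indep_family_def)
  then obtain I where I: "I \<subseteq> insert e B" "f I < card I" by (auto simp: not_le)
  have eI: "e \<in> I"
  proof (rule ccontr)
    assume "e \<notin> I"
    with I(1) have "I \<subseteq> B" by blast
    with I(2) show False using indep_familyD[OF B] not_le by blast
  qed
  have "finite I" by (rule finite_subset[OF subset_trans[OF I(1) eB] S])
  define C where "C = I - {e}"
  have C: "C \<subseteq> B" "insert e C = I" using I(1) eI by (auto simp: C_def)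
  have card_I: "card I = Suc (card C)"
    unfolding C_def by (rule card.remove[OF \<open>finite I\<close> eI])
  have "card C \<le> f C" by (rule indep_familyD[OF B C(1)])
  moreover have "f C \<le> f I" using C(2) I(1) eB by (intro mono) auto
  ultimately show ?thesis using that[of C] C card_I I(2) by simp
qed

text \<open>Weak duality: elements of \<open>X\<close> in \<open>T'\<close> are counted singly, and
  those in a part \<open>A\<close> number at most \<open>f (X \<inter> A) \<le> f A\<close>.\<close>

lemma card_indep_le_sum_partition:
  assumes S: "finite S"
    and mono: "\<And>X Y. X \<subseteq> Y \<Longrightarrow> Y \<subseteq> S \<Longrightarrow> f X \<le> f Y"
    and X: "X \<in> indep_family S f" and XT: "X \<subseteq> T" and T: "T \<subseteq> S"
    and T': "T' \<subseteq> T" and P: "partition_on (T - T') P"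
  shows "card X \<le> card T' + (\<Sum>A\<in>P. f A)"
proof -
  have fT: "finite T" using S T finite_subset by blast
  have fP: "finite P" using P fT finite_elements by blast
  have "X \<subseteq> T' \<union> (\<Union>A\<in>P. X \<inter> A)"
    using XT P by (auto simp: partition_on_def)
  moreover have "finite (T' \<union> (\<Union>A\<in>P. X \<inter> A))"
    using fT T' XT fP finite_subset by (metis finite_Int finite_UN finite_UnI)
  ultimately have "card X \<le> card (T' \<union> (\<Union>A\<in>P. X \<inter> A))" by (rule card_mono[rotated])
  also have "\<dots> \<le> card T' + card (\<Union>A\<in>P. X \<inter> A)" by (rule card_Un_le)
  also have "card (\<Union>A\<in>P. X \<inter> A) \<le> (\<Sum>A\<in>P. card (X \<inter> A))" using fP by (rule card_UN_le)
  also have "\<dots> \<le> (\<Sum>A\<in>P. f A)"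
  proof (rule sum_mono)
    fix A assume "A \<in> P"
    then have "A \<subseteq> S" using P T by (auto simp: partition_on_def)
    have "card (X \<inter> A) \<le> f (X \<inter> A)" using indep_familyD[OF X] by simp
    also have "\<dots> \<le> f A" using \<open>A \<subseteq> S\<close> by (intro mono) auto
    finally show "card (X \<inter> A) \<le> f A" .
  qed
  finally show ?thesis by simp
qed

text \<open>Uncrossing. Submodularity is assumed only for the pair at hand, because
  \<open>f1\<close> satisfies it only for certain pairs.\<close>

lemma tight_Un:
  assumes B: "B \<in> indep_family S f" and S: "finite S"
    and C: "C \<subseteq> B" "f C = card C" and D: "D \<subseteq> B" "f D = card D"
    and sub: "f (C \<union> D) + f (C \<inter> D) \<le> f C + f D"
  shows "f (C \<union> D) = card (C \<union> D)"
proof -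
  have "finite B" using B S finite_subset by (auto simp: indep_family_def)
  then have "finite C" "finite D" using C D finite_subset by blast+
  then have "card C + card D = card (C \<union> D) + card (C \<inter> D)" by (rule card_Un_Int)
  moreover have "card (C \<union> D) \<le> f (C \<union> D)" "card (C \<inter> D) \<le> f (C \<inter> D)"
    using C D by (auto intro!: indep_familyD[OF B])
  ultimately show ?thesis using C D sub by simp
qed

section \<open>Dilworth truncations\<close>

lemma finite_partition_sums: "finite T \<Longrightarrow> finite {\<Sum>X\<in>P. f X | P. partition_on T P}"
  using finitely_many_partition_on[of T] by simp

lemma dilworth_truncation_le:
  "finite T \<Longrightarrow> partition_on T P \<Longrightarrow> dilworth_truncation f T \<le> (\<Sum>X\<in>P. f X)"
  unfolding dilworth_truncation_def by (rule Min_le) (auto intro: finite_partition_sums)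

lemma dilworth_truncation_attained:
  assumes "finite T"
  obtains P where "partition_on T P" "dilworth_truncation f T = (\<Sum>X\<in>P. f X)"
proof -
  have "\<exists>P. partition_on T P"
    using partition_on_empty partition_on_space by (cases "T = {}") blast+
  then have "dilworth_truncation f T \<in> {\<Sum>X\<in>P. f X | P. partition_on T P}"
    unfolding dilworth_truncation_def
    by (intro Min_in finite_partition_sums assms) auto
  with that show ?thesis by blast
qed

lemma finite_deletion_partition_sums:
  assumes "finite T"
  shows "finite {card T' + (\<Sum>X\<in>P. f X) | T' P. T' \<subseteq> T \<and> partition_on (T - T') P}"
proof -
  have "{card T' + (\<Sum>X\<in>P. f X) | T' P. T' \<subseteq> T \<and> partition_on (T - T') P} =
    (\<Union>T'\<in>Pow T. (\<lambda>P. card T' + (\<Sum>X\<in>P. f X)) ` {P. partition_on (T - T') P})" by auto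
  then show ?thesis using assms by (simp add: finitely_many_partition_on)
qed

lemma Min_eq_Min_if:
  fixes A B :: "'a::linorder set"
  assumes "finite A" "finite B" "A \<noteq> {}"
    and AB: "\<And>a. a \<in> A \<Longrightarrow> \<exists>b\<in>B. b \<le> a" and BA: "\<And>b. b \<in> B \<Longrightarrow> \<exists>a\<in>A. a \<le> b"
  shows "Min A = Min B"
proof -
  have "B \<noteq> {}" using assms by blast
  then show ?thesis
    using assms by (intro antisym) (simp_all add: Min_le_iff)
qed

text \<open>The truncation is itself a minimum over partitions, attained by one of them, so the
  nested minimum is the joint one.\<close>

lemma Min_dilworth_truncation:
  assumes T: "finite T"
  shows "Min {card T' + dilworth_truncation f (T - T') | T'. T' \<subseteq> T} =
    Min {card T' + (\<Sum>X\<in>P. f X) | T' P. T' \<subseteq> T \<and> partition_on (T - T') P}"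
    (is "Min ?A = Min ?B")
proof (rule Min_eq_Min_if)
  show "finite ?A" using T by simp
  show "finite ?B" using T by (rule finite_deletion_partition_sums)
  show "?A \<noteq> {}" by blast
  show "\<exists>m\<in>?B. m \<le> n" if "n \<in> ?A" for n
  proof -
    from that obtain T' where T': "T' \<subseteq> T" "n = card T' + dilworth_truncation f (T - T')"
      by blast
    obtain P where "partition_on (T - T') P" "dilworth_truncation f (T - T') = (\<Sum>X\<in>P. f X)"
      using dilworth_truncation_attained[OF finite_Diff[OF T]] .
    with T' have "n \<in> ?B" by auto
    then show ?thesis by (rule bexI[rotated]) simp
  qed
  show "\<exists>n\<in>?A. n \<le> m" if "m \<in> ?B" for m
  proof -
    from that obtain T' P where P: "T' \<subseteq> T" "partition_on (T - T') P" "m = card T' + (\<Sum>X\<in>P. f X)"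
      by blast
    show ?thesis
    proof (rule bexI)
      show "card T' + dilworth_truncation f (T - T') \<le> m"
        using P dilworth_truncation_le[of "T - T'" P f] T by simp
      show "card T' + dilworth_truncation f (T - T') \<in> ?A" using P by blast
    qed
  qed
qed

section \<open>The function \<open>f0\<close>\<close>

lemma verts_mono: "X \<subseteq> Y \<Longrightarrow> verts ends X \<subseteq> verts ends Y"
  by (auto simp: verts_def)

lemma verts_Un: "verts ends (X \<union> Y) = verts ends X \<union> verts ends Y"
  by (auto simp: verts_def)

lemma verts_insert: "verts ends (insert e X) = ends e \<union> verts ends X"
  by (auto simp: verts_def)

context looped_simple_graph
begin

lemma finite_ground: "finite (E \<union> L)"
  using finite_E finite_L by simp

lemma ends_subset: "e \<in> E \<union> L \<Longrightarrow> ends e \<subseteq> V"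
  using edge_ends loop_ends by blast

lemma ends_nonempty: "e \<in> E \<union> L \<Longrightarrow> ends e \<noteq> {}"
  using edge_ends loop_ends by fastforce

lemma finite_verts: "X \<subseteq> E \<union> L \<Longrightarrow> finite (verts ends X)"
  unfolding verts_def using ends_subset finite_V by (meson UN_least finite_subset subsetD)

lemma card_verts_mono: "X \<subseteq> Y \<Longrightarrow> Y \<subseteq> E \<union> L \<Longrightarrow> card (verts ends X) \<le> card (verts ends Y)"
  by (simp add: card_mono finite_verts verts_mono)

lemma f0_mono: "X \<subseteq> Y \<Longrightarrow> Y \<subseteq> E \<union> L \<Longrightarrow> f0 ends t X \<le> f0 ends t Y"
  by (simp add: f0_def card_verts_mono)

lemma card_verts_Un:
  assumes "C \<subseteq> E \<union> L" "D \<subseteq> E \<union> L"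
  shows "t * card (verts ends (C \<union> D)) + t * card (verts ends C \<inter> verts ends D) =
    t * card (verts ends C) + t * card (verts ends D)"
  using card_Un_Int[OF finite_verts finite_verts, OF assms]
  by (simp add: verts_Un flip: add_mult_distrib2)

lemma card_verts_Int_le:
  assumes "C \<subseteq> E \<union> L"
  shows "card (verts ends (C \<inter> D)) \<le> card (verts ends C \<inter> verts ends D)"
  using assms finite_verts by (intro card_mono) (auto simp: verts_def)

lemma f0_submodular:
  assumes "C \<subseteq> E \<union> L" "D \<subseteq> E \<union> L"
  shows "f0 ends t (C \<union> D) + f0 ends t (C \<inter> D) \<le> f0 ends t C + f0 ends t D"
  unfolding f0_def
  using card_verts_Un[OF assms, of t] mult_le_mono2[OF card_verts_Int_le[OF assms(1), of D], of t]
  by linarith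

lemma f0_min_max:
  assumes t: "t \<ge> 1" and T: "T \<subseteq> E \<union> L" and B: "B \<in> indep_family (E \<union> L) (f0 ends t)"
    and BT: "B \<subseteq> T" and max: "\<And>e. e \<in> T - B \<Longrightarrow> insert e B \<notin> indep_family (E \<union> L) (f0 ends t)"
  shows "card B \<in> {card T' + f0 ends t (T - T') | T'. T' \<subseteq> T}"
proof -
  let ?K = "{C. C \<subseteq> B \<and> f0 ends t C = card C}"
  have BS: "B \<subseteq> E \<union> L" using BT T by blast
  then have fB: "finite B" using finite_ground finite_subset by blast
  then have "finite ?K" by simp
  moreover have "{} \<in> ?K" by (simp add: f0_def verts_def)
  ultimately obtain C where C: "C \<in> ?K" and Cmax: "\<And>D. D \<in> ?K \<Longrightarrow> C \<subseteq> D \<Longrightarrow> C = D"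
    using finite_has_maximal2[of ?K "{}"] by auto
  \<comment> \<open>Since \<open>f0\<close> is submodular on all pairs, tight sets are closed under
    union and a maximal one contains all others.\<close>
  have largest: "D \<subseteq> C" if "D \<in> ?K" for D
  proof -
    have "f0 ends t (C \<union> D) = card (C \<union> D)"
      using C that BS by (intro tight_Un[OF B finite_ground] f0_submodular) auto
    then have "C = C \<union> D" using C that by (intro Cmax) auto
    then show ?thesis by blast
  qed
  have spanned: "ends e \<subseteq> verts ends C" if e: "e \<in> T - B" for e
  proof -
    obtain D where D: "D \<subseteq> B" "f0 ends t D = card D" "f0 ends t (insert e D) = card D"
      using tight_set_if_not_extendable[OF finite_ground f0_mono B _ max[OF e]] e T by blast
    have eD: "insert e D \<subseteq> E \<union> L" using D e BS T by blast
    \<comment> \<open>Cancelling the factor \<open>t\<close> uses \<open>t \<ge> 1\<close>.\<close>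
    have "card (verts ends (insert e D)) = card (verts ends D)"
      using D t by (simp add: f0_def flip: D(2))
    then have "verts ends D = verts ends (insert e D)"
      by (intro card_subset_eq finite_verts[OF eD] verts_mono) auto
    then have "ends e \<subseteq> verts ends D" by (auto simp: verts_insert)
    also have "\<dots> \<subseteq> verts ends C" using largest D by (intro verts_mono) auto
    finally show ?thesis .
  qed
  \<comment> \<open>The minimizer is \<open>T' = B - C\<close>: its complement in \<open>T\<close>
    has the same vertices as \<open>C\<close>, hence the value \<open>card C\<close>.\<close>
  have "T - (B - C) = C \<union> (T - B)" using C BT by auto
  moreover have "verts ends (C \<union> (T - B)) = verts ends C"
    using spanned by (auto simp: verts_def)
  ultimately have "f0 ends t (T - (B - C)) = card C"
    using C by (simp add: f0_def)
  moreover have "card B = card (B - C) + card C"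
    using C fB card_mono[of B C] finite_subset[of C B] by (simp add: card_Diff_subset)
  ultimately show ?thesis using BT by (intro CollectI exI[of _ "B - C"]) auto
qed

section \<open>The function \<open>f1\<close> on big sets\<close>

definition big :: "nat \<Rightarrow> 'e set \<Rightarrow> bool"
  where "big t X \<longleftrightarrow> \<not> (X \<subseteq> E \<and> card (verts ends X) \<le> 2 * t)"

definition reduced :: "nat \<Rightarrow> 'e set \<Rightarrow> bool"
  where "reduced t X \<longleftrightarrow> X \<subseteq> E \<and> card (verts ends X) = 2 * t + 1"

text \<open>For big \<open>C\<close> this describes the elements whose insertion leaves
  \<open>f1\<close> unchanged: a loop would cancel the \<open>- 1\<close> of a reduced set.\<close>

definition spans :: "nat \<Rightarrow> 'e set \<Rightarrow> 'e \<Rightarrow> bool"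
  where "spans t C e \<longleftrightarrow> ends e \<subseteq> verts ends C \<and> (reduced t C \<longrightarrow> e \<in> E)"

lemma f1_small: "\<not> big t X \<Longrightarrow> f1 E ends t X = card X"
  by (simp add: f1_def big_def)

lemma f1_big: "big t X \<Longrightarrow> f1 E ends t X = t * card (verts ends X) - of_bool (reduced t X)"
  by (auto simp: f1_def big_def reduced_def)

lemma f1_big_le: "big t X \<Longrightarrow> f1 E ends t X \<le> t * card (verts ends X)"
  by (simp add: f1_big)

lemma f1_big_ge:
  assumes "big t X"
  shows "t * card (verts ends X) \<le> f1 E ends t X + 1"
proof -
  have "n \<le> n - of_bool b + 1" for n :: nat and b by (cases b) simp_all
  then show ?thesis unfolding f1_big[OF assms] .
qed

lemma big_mono:
  assumes "big t X" "X \<subseteq> Y" "Y \<subseteq> E \<union> L"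
  shows "big t Y"
  using assms card_verts_mono[OF assms(2,3)] by (auto simp: big_def)

lemma reduced_imp_big: "reduced t X \<Longrightarrow> big t X"
  by (auto simp: big_def reduced_def)

text \<open>Inside a reduced set, big means at least \<open>2 * t + 1\<close> vertices, which is
  already all of them.\<close>

lemma reduced_subset:
  assumes "reduced t Y" "big t X" "X \<subseteq> Y"
  shows "reduced t X" "verts ends X = verts ends Y"
proof -
  have Y: "Y \<subseteq> E \<union> L" and XE: "X \<subseteq> E" using assms by (auto simp: reduced_def)
  have "card (verts ends X) = card (verts ends Y)"
    using assms card_verts_mono[OF assms(3) Y] XE by (auto simp: reduced_def big_def)
  then show "verts ends X = verts ends Y"
    using finite_verts[OF Y] verts_mono[OF assms(3)] by (intro card_subset_eq)
  with assms(1) XE show "reduced t X" by (simp add: reduced_def)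
qed

text \<open>As there are no parallel edges, \<open>ends\<close> embeds \<open>X\<close> into the
  vertex pairs.\<close>

lemma card_edges_le:
  assumes "X \<subseteq> E"
  shows "2 * card X \<le> card (verts ends X) * (card (verts ends X) - 1)"
proof -
  let ?W = "verts ends X"
  have fin: "finite ?W" using assms finite_verts by blast
  have "card X = card (ends ` X)"
    using assms simple_edges by (metis card_image inj_on_subset)
  also have "\<dots> \<le> card {e. e \<subseteq> ?W \<and> card e = 2}"
    using assms edge_ends fin by (intro card_mono) (auto simp: verts_def)
  also have "\<dots> = card ?W choose 2" using fin by (rule n_subsets)
  finally show ?thesis by (simp add: choose_two)
qed

text \<open>The slack of 2 pays for two values lowered by 1, or for one such value and one extra
  element. \<open>W\<close> may exceed the vertices of \<open>X\<close>, so that empty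
  \<open>X\<close> is covered too.\<close>

lemma small_bound:
  assumes t: "t \<ge> 2" and X: "X \<subseteq> E" "card (verts ends X) \<le> 2 * t"
    and W: "verts ends X \<subseteq> W" "finite W" "W \<noteq> {}"
  shows "card X + 2 \<le> t * card W"
proof -
  define m where "m = card (verts ends X)"
  have X2: "2 * card X \<le> m * (m - 1)" using card_edges_le[OF X(1)] by (simp add: m_def)
  have mW: "m \<le> card W" using W by (simp add: m_def card_mono)
  have W1: "1 \<le> card W" using W by (simp add: Suc_le_eq card_gt_0_iff)
  show ?thesis
  proof (cases m)
    case 0
    have "2 * 1 \<le> t * card W" using t W1 by (rule mult_le_mono)
    with 0 X2 show ?thesis by simp
  next
    case (Suc k)
    obtain d where d: "2 * t = m + d" using X(2) le_Suc_ex unfolding m_def by blast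
    \<comment> \<open>The difference between \<open>2 * t * m\<close> and \<open>m * (m - 1)\<close>
      is \<open>m * (d + 1)\<close>, which is at least \<open>m + d = 2 * t \<ge> 4\<close>.\<close>
    have "4 \<le> m * (d + 1)"
    proof -
      have "4 \<le> m + d" using t d by simp
      also have "\<dots> \<le> m * (d + 1)" using Suc by simp
      finally show ?thesis .
    qed
    moreover have "2 * (t * m) = m * (m + d)" using d by (metis mult.assoc mult.commute)
    moreover have "m * (m - 1) + m = m * m" using Suc by simp
    ultimately have "m * (m - 1) + 4 \<le> 2 * (t * m)" by (simp add: algebra_simps)
    with X2 have "card X + 2 \<le> t * m" by linarith
    also have "\<dots> \<le> t * card W" using mW by simp
    finally show ?thesis .
  qed
qed

text \<open>Two cases are delicate. A big subset of a reduced set is reduced with the same vertices;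
  and from a small to a big set, \<open>small_bound\<close> outweighs a possible
  \<open>- 1\<close>.\<close>

lemma f1_mono:
  assumes t: "t \<ge> 2" and XY: "X \<subseteq> Y" and Y: "Y \<subseteq> E \<union> L"
  shows "f1 E ends t X \<le> f1 E ends t Y"
proof (cases "big t Y")
  case False
  then have "\<not> big t X" using XY Y big_mono by blast
  moreover have "card X \<le> card Y" using XY Y finite_ground by (meson card_mono finite_subset)
  ultimately show ?thesis using False by (simp add: f1_small)
next
  case bigY: True
  show ?thesis
  proof (cases "big t X")
    case True
    show ?thesis
    proof (cases "reduced t Y")
      case red: True
      show ?thesis using reduced_subset[OF red True XY] red True bigY by (simp add: f1_big)
    next
      case False
      have "f1 E ends t X \<le> t * card (verts ends X)" using True by (rule f1_big_le)
      also have "\<dots> \<le> t * card (verts ends Y)" using XY Y by (simp add: card_verts_mono)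
      also have "\<dots> = f1 E ends t Y" using False bigY by (simp add: f1_big)
      finally show ?thesis .
    qed
  next
    case False
    have "verts ends Y \<noteq> {}"
    proof
      assume "verts ends Y = {}"
      then have "Y = {}" using Y ends_nonempty by (fastforce simp: verts_def)
      with bigY show False by (simp add: big_def verts_def)
    qed
    then have "card X + 2 \<le> t * card (verts ends Y)"
      using False by (intro small_bound[OF t] verts_mono[OF XY] finite_verts[OF Y])
        (auto simp: big_def)
    then show ?thesis using f1_big_ge[OF bigY] f1_small[OF False] by simp
  qed
qed

text \<open>The intersection has the vertices and value of \<open>C\<close>, so \<open>D\<close>
  covers the vertices of \<open>C\<close> and the union costs no more than \<open>D\<close>.\<close>

lemma f1_submodular_reduced:
  assumes C: "C \<subseteq> E \<union> L" and D: "D \<subseteq> E \<union> L" "big t D"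
    and red: "reduced t C" and int: "big t (C \<inter> D)"
  shows "f1 E ends t (C \<union> D) + f1 E ends t (C \<inter> D) \<le> f1 E ends t C + f1 E ends t D"
proof -
  have I: "reduced t (C \<inter> D)" "verts ends (C \<inter> D) = verts ends C"
    using reduced_subset[OF red int] by auto
  then have "f1 E ends t (C \<inter> D) = f1 E ends t C"
    using red int reduced_imp_big by (simp add: f1_big)
  moreover have "verts ends C \<subseteq> verts ends D"
    using I(2) verts_mono[of "C \<inter> D" D ends] by simp
  then have U: "verts ends (C \<union> D) = verts ends D" by (auto simp: verts_Un)
  have bigU: "big t (C \<union> D)" using C D by (intro big_mono[OF D(2)]) auto
  \<comment> \<open>A \<open>- 1\<close> in the value of \<open>D\<close> must survive in the union;
    it does, because \<open>C\<close> contains only edges.\<close>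
  have "reduced t D \<Longrightarrow> reduced t (C \<union> D)" using U red by (simp add: reduced_def)
  then have "f1 E ends t (C \<union> D) \<le> f1 E ends t D"
    using D(2) bigU U by (auto simp: f1_big)
  ultimately show ?thesis by simp
qed

lemma f1_submodular_big:
  assumes t: "t \<ge> 2" and C: "C \<subseteq> E \<union> L" "big t C" and D: "D \<subseteq> E \<union> L" "big t D"
    and meet: "verts ends C \<inter> verts ends D \<noteq> {}"
  shows "f1 E ends t (C \<union> D) + f1 E ends t (C \<inter> D) \<le> f1 E ends t C + f1 E ends t D"
proof -
  let ?W = "verts ends C \<inter> verts ends D"
  have bigU: "big t (C \<union> D)" using C D by (intro big_mono[OF C(2)]) auto
  note U = card_verts_Un[OF C(1) D(1), of t] f1_big_le[OF bigU]
  consider "\<not> big t (C \<inter> D)" | "big t (C \<inter> D)" "reduced t C" | "big t (C \<inter> D)" "reduced t D"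
    | "big t (C \<inter> D)" "\<not> reduced t C" "\<not> reduced t D" by blast
  then show ?thesis
  proof cases
    case 1
    \<comment> \<open>The slack of 2 compensates for \<open>C\<close> and \<open>D\<close> both
      being reduced. A common vertex makes \<open>?W\<close> nonempty even when
      \<open>C \<inter> D\<close> is empty.\<close>
    have "card (C \<inter> D) + 2 \<le> t * card ?W"
      using 1 meet finite_verts[OF C(1)]
      by (intro small_bound[OF t]) (auto simp: big_def verts_def)
    then show ?thesis
      using f1_big_ge[OF C(2)] f1_big_ge[OF D(2)] f1_small[OF 1] U by linarith
  next
    case 2
    then show ?thesis using f1_submodular_reduced[OF C(1) D] by simp
  next
    case 3
    then show ?thesis using f1_submodular_reduced[OF D(1) C] by (simp add: ac_simps)
  next
    case 4
    have "f1 E ends t (C \<inter> D) \<le> t * card (verts ends (C \<inter> D))" using 4 by (intro f1_big_le)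
    also have "\<dots> \<le> t * card ?W" using card_verts_Int_le[OF C(1)] by simp
    finally show ?thesis using 4 C(2) D(2) U by (simp add: f1_big)
  qed
qed

text \<open>A new vertex would add \<open>t \<ge> 2\<close>, more than a \<open>- 1\<close> can
  hide. With the vertices unchanged, a loop added to a reduced set would raise the value by
  1.\<close>

lemma spans_if_f1_insert:
  assumes t: "t \<ge> 2" and C: "C \<subseteq> E \<union> L" "big t C" and e: "e \<in> E \<union> L"
    and eq: "f1 E ends t (insert e C) = f1 E ends t C"
  shows "spans t C e"
proof -
  have eC: "insert e C \<subseteq> E \<union> L" using C e by blast
  have bige: "big t (insert e C)" using big_mono[OF C(2) _ eC] by blast
  have sub: "verts ends C \<subseteq> verts ends (insert e C)" by (auto simp: verts_insert)
  have "card (verts ends (insert e C)) \<le> card (verts ends C)"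
  proof (rule ccontr)
    assume "\<not> ?thesis"
    then have "t * (card (verts ends C) + 1) \<le> t * card (verts ends (insert e C))"
      by (intro mult_le_mono2) linarith
    then show False
      using f1_big_ge[OF bige] f1_big_le[OF C(2)] eq t by simp
  qed
  then have same: "verts ends C = verts ends (insert e C)"
    by (rule card_seteq[OF finite_verts[OF eC] sub])
  have "e \<in> E" if red: "reduced t C"
  proof (rule ccontr)
    assume "e \<notin> E"
    then have "\<not> reduced t (insert e C)" by (simp add: reduced_def)
    \<comment> \<open>Positivity makes the natural-number subtraction of 1 below a strict
      decrease.\<close>
    moreover have "card (verts ends C) > 0" using red by (simp add: reduced_def)
    with t have "0 < t * card (verts ends C)" by simp
    moreover have "t * card (verts ends C) = t * card (verts ends C) - 1"
      using eq bige C(2) red \<open>\<not> reduced t (insert e C)\<close> by (simp add: f1_big flip: same)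
    ultimately show False by linarith
  qed
  then show ?thesis using same by (auto simp: spans_def verts_insert)
qed

text \<open>The edge condition is inherited because a reduced \<open>D\<close> forces its big subset
  \<open>C\<close> to be reduced.\<close>

lemma spans_mono:
  assumes "spans t C e" "big t C" "C \<subseteq> D" "D \<subseteq> E \<union> L"
  shows "spans t D e"
  using assms reduced_subset[of t D C] verts_mono[of C D ends] by (auto simp: spans_def)

lemma f1_Un_spanned:
  assumes C: "big t C" and A: "\<And>e. e \<in> A \<Longrightarrow> spans t C e" and CA: "C \<union> A \<subseteq> E \<union> L"
  shows "f1 E ends t (C \<union> A) = f1 E ends t C"
proof -
  have same: "verts ends (C \<union> A) = verts ends C" using A by (auto simp: verts_def spans_def)
  moreover have "reduced t (C \<union> A) = reduced t C"
    using A same by (auto simp: reduced_def spans_def)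
  moreover have "big t (C \<union> A)" using big_mono[OF C _ CA] by blast
  ultimately show ?thesis using C by (simp add: f1_big)
qed

text \<open>A small \<open>C\<close> cannot block \<open>e\<close>: the value of
  \<open>insert e C\<close> is at least \<open>card C + 1\<close>, by counting if that set is small
  and by \<open>small_bound\<close> if it is big.\<close>

lemma big_tight_set_if_not_extendable:
  assumes t: "t \<ge> 2" and B: "B \<in> indep_family (E \<union> L) (f1 E ends t)" and e: "e \<in> (E \<union> L) - B"
    and dep: "insert e B \<notin> indep_family (E \<union> L) (f1 E ends t)"
  obtains C where "C \<subseteq> B" "big t C" "f1 E ends t C = card C" "spans t C e"
proof -
  have BS: "B \<subseteq> E \<union> L" using B by (simp add: indep_family_def)
  obtain C where C: "C \<subseteq> B" "f1 E ends t C = card C" "f1 E ends t (insert e C) = card C"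
    using tight_set_if_not_extendable[OF finite_ground f1_mono[OF t] B e dep] by blast
  have eC: "insert e C \<subseteq> E \<union> L" using C BS e by blast
  have "big t C"
  proof (rule ccontr)
    assume small: "\<not> big t C"
    have "finite C" using finite_subset[OF eC finite_ground] by simp
    moreover have "e \<notin> C" using C(1) e by blast
    ultimately have "card (insert e C) = card C + 1" by simp
    then have bige: "big t (insert e C)" using C(3) f1_small[of t "insert e C"] by fastforce
    have "card C + 2 \<le> t * card (verts ends (insert e C))"
      using small ends_nonempty[of e] e
      by (intro small_bound[OF t] finite_verts[OF eC]) (auto simp: big_def verts_insert)
    then show False using f1_big_ge[OF bige] C(3) by simp
  qed
  moreover have "spans t C e"
    using C eC e by (intro spans_if_f1_insert t \<open>big t C\<close>) simp_all
  ultimately show ?thesis using that[OF C(1)] C(2) by blast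
qed

lemma f1_min_max:
  assumes t: "t \<ge> 2" and T: "T \<subseteq> E \<union> L" and B: "B \<in> indep_family (E \<union> L) (f1 E ends t)"
    and BT: "B \<subseteq> T" and max: "\<And>e. e \<in> T - B \<Longrightarrow> insert e B \<notin> indep_family (E \<union> L) (f1 E ends t)"
  shows "card B \<in> {card T' + (\<Sum>X\<in>P. f1 E ends t X) | T' P. T' \<subseteq> T \<and> partition_on (T - T') P}"
proof -
  let ?f = "f1 E ends t"
  have BS: "B \<subseteq> E \<union> L" using BT T by blast
  then have fB: "finite B" using finite_ground finite_subset by blast
  \<comment> \<open>\<open>K\<close> holds the big tight sets and \<open>M\<close> the maximal ones;
    the sets \<open>cl C\<close> for \<open>C\<close> in \<open>M\<close> become the parts of the
    partition.\<close>
  define K where "K = {C. C \<subseteq> B \<and> big t C \<and> ?f C = card C}"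
  define M where "M = {C \<in> K. \<forall>D\<in>K. C \<subseteq> D \<longrightarrow> C = D}"
  define cl where "cl C = C \<union> {e \<in> T - B. spans t C e}" for C
  have fK: "finite K" unfolding K_def using fB by simp
  then have fM: "finite M" by (simp add: M_def)
  have MD: "C \<subseteq> B" "big t C" "?f C = card C" if "C \<in> M" for C
    using that by (auto simp: M_def K_def)
  have above: "\<exists>D\<in>M. C \<subseteq> D" if "C \<in> K" for C
    using finite_has_maximal2[OF fK that] by (auto simp: M_def)
  \<comment> \<open>If the vertex sets meet, uncrossing makes the union big and tight, and
    maximality identifies both sets with it.\<close>
  have meet: "C = D" if CD: "C \<in> M" "D \<in> M" and ne: "verts ends C \<inter> verts ends D \<noteq> {}" for C D
  proof -
    note C = MD[OF CD(1)] and D = MD[OF CD(2)]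
    have sub: "C \<subseteq> E \<union> L" "D \<subseteq> E \<union> L" using C D BS by blast+
    have "?f (C \<union> D) = card (C \<union> D)"
      by (intro tight_Un[OF B finite_ground] f1_submodular_big t C D sub ne)
    moreover have "big t (C \<union> D)" using sub by (intro big_mono[OF C(2)]) auto
    ultimately have "C \<union> D \<in> K" using C D by (simp add: K_def)
    then have "C = C \<union> D" "D = C \<union> D" using CD by (auto simp: M_def)
    then show ?thesis by simp
  qed
  have cl_verts: "ends e \<subseteq> verts ends C" if "e \<in> cl C" for e C
    using that by (auto simp: cl_def spans_def verts_def)
  have cl_T: "cl C \<subseteq> T" if "C \<in> M" for C
    using MD(1)[OF that] BT by (auto simp: cl_def)
  \<comment> \<open>Closures gain no vertices and every element has an end, so a shared element
    gives a shared vertex of \<open>C\<close> and \<open>D\<close>.\<close>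
  have cl_disj: "C = D" if "C \<in> M" "D \<in> M" "e \<in> cl C" "e \<in> cl D" for C D e
  proof -
    have "ends e \<noteq> {}" using that cl_T T ends_nonempty by blast
    then show ?thesis using that cl_verts[of e C] cl_verts[of e D] by (intro meet) auto
  qed
  have cl_ne: "cl C \<noteq> {}" if "C \<in> M" for C
    using MD(2)[OF that] by (auto simp: cl_def big_def verts_def)
  have inj: "inj_on cl M"
    using cl_disj cl_ne by (intro inj_onI) (metis ex_in_conv)
  have f_cl: "?f (cl C) = card C" if "C \<in> M" for C
    using f1_Un_spanned[of t C "{e \<in> T - B. spans t C e}"] MD[OF that] cl_T[OF that] T
    by (auto simp: cl_def)
  \<comment> \<open>Elements of \<open>B\<close> outside all maximal big tight sets are charged one
    each.\<close>
  define T' where "T' = B - \<Union>M"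
  have "T - T' = \<Union>(cl ` M)"
  proof (rule antisym)
    show "T - T' \<subseteq> \<Union>(cl ` M)"
    proof
      fix e assume e: "e \<in> T - T'"
      show "e \<in> \<Union>(cl ` M)"
      proof (cases "e \<in> B")
        case True
        then show ?thesis using e by (auto simp: T'_def cl_def)
      next
        case False
        \<comment> \<open>The big tight set blocking \<open>e\<close> lies below a maximal one,
          which then spans \<open>e\<close> as well.\<close>
        then obtain C where C: "C \<subseteq> B" "big t C" "?f C = card C" "spans t C e"
          using big_tight_set_if_not_extendable[OF t B _ max] e T by blast
        then obtain D where D: "D \<in> M" "C \<subseteq> D" using above[of C] by (auto simp: K_def)
        then have "spans t D e"
          using spans_mono[OF C(4,2)] MD(1)[OF D(1)] BS by blast
        then show ?thesis using D e False by (auto simp: cl_def)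
      qed
    qed
    have "cl C \<inter> T' = {}" if "C \<in> M" for C
      using that by (auto simp: cl_def T'_def)
    then show "\<Union>(cl ` M) \<subseteq> T - T'" using cl_T by blast
  qed
  moreover have "disjnt X Y" if XY: "X \<in> cl ` M" "Y \<in> cl ` M" "X \<noteq> Y" for X Y
  proof -
    obtain C D where CD: "C \<in> M" "D \<in> M" "X = cl C" "Y = cl D" using XY by blast
    then have "C \<noteq> D" using XY(3) by blast
    then show ?thesis using cl_disj[OF CD(1,2)] CD(3,4) by (auto simp: disjnt_iff)
  qed
  moreover have "{} \<notin> cl ` M" using cl_ne by fastforce
  ultimately have part: "partition_on (T - T') (cl ` M)"
    by (intro partition_onI) simp_all
  have "card (\<Union>M) = (\<Sum>C\<in>M. card C)"
  proof (rule card_Union_disjoint)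
    show "pairwise disjnt M"
      using cl_disj by (auto simp: pairwise_def disjnt_def cl_def)
    show "finite C" if "C \<in> M" for C using MD(1)[OF that] fB finite_subset by blast
  qed
  also have "\<dots> = (\<Sum>X\<in>cl ` M. ?f X)"
    using inj f_cl by (simp add: sum.reindex)
  finally have sum: "card (\<Union>M) = (\<Sum>X\<in>cl ` M. ?f X)" .
  have "\<Union>M \<subseteq> B" using MD(1) by blast
  then have "card B = card T' + card (\<Union>M)"
    unfolding T'_def using fB by (metis card_Diff_subset card_mono finite_subset le_add_diff_inverse2)
  moreover have "T' \<subseteq> T" using BT by (auto simp: T'_def)
  ultimately show ?thesis using part sum by auto
qed

end

section \<open>The two matroids\<close>

theorem theorem3p5:
  fixes V :: "'v set" and E L :: "'e set" and ends :: "'e \<Rightarrow> 'v set" and t :: nat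
  assumes "looped_simple_graph V E L ends"
  shows "(t \<ge> 1 \<longrightarrow>
      matroid (E \<union> L) (indep_family (E \<union> L) (f0 ends t)) \<and>
      (\<forall>T \<subseteq> E \<union> L.
        matroid_rank (indep_family (E \<union> L) (f0 ends t)) T
          = Min {card T' + f0 ends t (T - T') | T'. T' \<subseteq> T})) \<and>
    (t \<ge> 2 \<longrightarrow>
      matroid (E \<union> L) (indep_family (E \<union> L) (f1 E ends t)) \<and>
      (\<forall>T \<subseteq> E \<union> L.
        matroid_rank (indep_family (E \<union> L) (f1 E ends t)) T
          = Min {card T' + dilworth_truncation (f1 E ends t) (T - T') | T'. T' \<subseteq> T} \<and>
        Min {card T' + dilworth_truncation (f1 E ends t) (T - T') | T'. T' \<subseteq> T}
          = Min {card T' + (\<Sum>X\<in>P. f1 E ends t X) | T' P. T' \<subseteq> T \<and> partition_on (T - T') P}))"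
proof -
  interpret looped_simple_graph V E L ends by (rule assms)
  have ground: "X \<subseteq> E \<union> L" if "X \<in> indep_family (E \<union> L) f" for X and f :: "'e set \<Rightarrow> nat"
    using that by (simp add: indep_family_def)
  have fin: "finite T" if "T \<subseteq> E \<union> L" for T
    using that finite_ground finite_subset by blast
  show ?thesis
  proof (intro conjI impI)
    assume t: "t \<ge> 1"
    let ?F = "\<lambda>T. {card T' + f0 ends t (T - T') | T'. T' \<subseteq> T}"
    have weak: "card X \<le> n"
      if T: "T \<subseteq> E \<union> L" and X: "X \<in> indep_family (E \<union> L) (f0 ends t)" "X \<subseteq> T" and n: "n \<in> ?F T"
      for T X n
    proof -
      obtain T' where T': "T' \<subseteq> T" "n = card T' + f0 ends t (T - T')" using n by blast
      \<comment> \<open>A single part recovers the formula without partitions; if nothing remains,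
        the partition is empty because parts are nonempty.\<close>
      have "partition_on (T - T') (if T - T' = {} then {} else {T - T'})"
        by (simp add: partition_on_def)
      from card_indep_le_sum_partition[OF finite_ground f0_mono X T T'(1) this]
      show ?thesis using T' by (auto split: if_splits)
    qed
    note mm = matroid_and_rank_of_min_max[where F = ?F, OF finite_ground ground
        empty_in_indep_family indep_family_subset weak f0_min_max[OF t]]
    show "matroid (E \<union> L) (indep_family (E \<union> L) (f0 ends t))" by (rule mm(1))
    show "\<forall>T \<subseteq> E \<union> L. matroid_rank (indep_family (E \<union> L) (f0 ends t)) T = Min (?F T)"
    proof (intro allI impI)
      fix T assume "T \<subseteq> E \<union> L"
      then show "matroid_rank (indep_family (E \<union> L) (f0 ends t)) T = Min (?F T)"
        by (intro mm(2)) (simp_all add: fin)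
    qed
  next
    assume t: "t \<ge> 2"
    \<comment> \<open>The abstract criterion is applied to the joint minimum over \<open>T'\<close>
      and \<open>P\<close>; the truncation form \<open>?G\<close> is derived from it
      afterwards.\<close>
    let ?F = "\<lambda>T. {card T' + (\<Sum>X\<in>P. f1 E ends t X) | T' P. T' \<subseteq> T \<and> partition_on (T - T') P}"
    let ?G = "\<lambda>T. {card T' + dilworth_truncation (f1 E ends t) (T - T') | T'. T' \<subseteq> T}"
    have weak: "card X \<le> n"
      if T: "T \<subseteq> E \<union> L" and X: "X \<in> indep_family (E \<union> L) (f1 E ends t)" "X \<subseteq> T" and n: "n \<in> ?F T"
      for T X n
      using card_indep_le_sum_partition[OF finite_ground f1_mono[OF t] X T] n by blast
    note mm = matroid_and_rank_of_min_max[where F = ?F, OF finite_ground ground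
        empty_in_indep_family indep_family_subset weak f1_min_max[OF t]]
    show "matroid (E \<union> L) (indep_family (E \<union> L) (f1 E ends t))" by (rule mm(1))
    show "\<forall>T \<subseteq> E \<union> L. matroid_rank (indep_family (E \<union> L) (f1 E ends t)) T = Min (?G T) \<and>
        Min (?G T) = Min (?F T)"
    proof (intro allI impI)
      fix T assume T: "T \<subseteq> E \<union> L"
      have "matroid_rank (indep_family (E \<union> L) (f1 E ends t)) T = Min (?F T)"
        by (rule mm(2)) (use finite_deletion_partition_sums[OF fin[OF T]] T in simp_all)
      then show "matroid_rank (indep_family (E \<union> L) (f1 E ends t)) T = Min (?G T) \<and>
        Min (?G T) = Min (?F T)"
        using Min_dilworth_truncation[OF fin[OF T], of "f1 E ends t"] by simp
    qed
  qed
qed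

end
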